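(* Let $D$ be the formal derivative on $\mathbb Q[a,b,c,d,t]$ with respect to the grammar $$\{a\rightarrow 3t(ad+bc),\ b\rightarrow 3t(ad+bc),\ c\rightarrow 2a,\ d\rightarrow 2b,\ t\rightarrow t^2(c+d)\}.$$ Then for every $n\ge2$, $$D^n(d)=(n+1)!\,\widetilde G_n(a,b,c,d;t).$$
   Context: A formal derivative with respect to a grammar (substitution rules $z\to f_z$ for variables $z$) is the linear operator $D$ with $D(z)=f_z$, $D(uv)=D(u)v+uD(v)$, $D(c_0)=0$ for constants $c_0$. A plane tree is an unlabeled rooted tree in which the children of every vertex are linearly ordered; $\mathcal P_n$ is the set of plane trees with $n$ edges. A leaf is a vertex with no children, an interior vertex one with at least one child. A leaf without siblings is a singleton leaf; a leaf with siblings is an elder leaf if it is the leftmost child of its parent, and a young leaf otherwise; an interior vertex is a young interior vertex if it is not the parent of a singleton leaf or of an elder leaf. An edge is a young edge if its lower endpoint (the child) is neither a singleton leaf nor an elder leaf. For $T\in\mathcal P_n$, $\mathrm{sleaf},\mathrm{eleaf},\mathrm{yleaf},\mathrm{yint},\mathrm{yedge}$ count singleton leaves, elder leaves, young leaves, young interior vertices and young edges. For $n\ge2$, $\widetilde G_n(a,b,c,d;t)=\sum_{T\in\mathcal P_n}a^{\mathrm{sleaf}(T)}b^{\mathrm{eleaf}(T)}c^{\mathrm{yleaf}(T)}d^{\mathrm{yint}(T)}t^{\mathrm{yedge}(T)}$. *)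

theory Defs
  imports Complex_Main "HOL-Library.Poly_Mapping"
begin

text \<open>
  Polynomials over the rationals in commuting variables \<open>'v\<close>: a monomial is a finitely supported
  exponent vector, a polynomial a finitely supported family of coefficients.
\<close>

type_synonym 'v qpoly = "('v \<Rightarrow>\<^sub>0 nat) \<Rightarrow>\<^sub>0 rat"

definition Const :: "rat \<Rightarrow> 'v qpoly" where
  "Const r = Poly_Mapping.single 0 r"

definition Var :: "'v \<Rightarrow> 'v qpoly" where
  "Var v = Poly_Mapping.single (Poly_Mapping.single v 1) 1"

definition formal_derivative :: "('v \<Rightarrow> 'v qpoly) \<Rightarrow> ('v qpoly \<Rightarrow> 'v qpoly) \<Rightarrow> bool" where
  "formal_derivative f D \<longleftrightarrow>
     (\<forall>p q. D (p + q) = D p + D q) \<and>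
     (\<forall>r p. D (Const r * p) = Const r * D p) \<and>
     (\<forall>p q. D (p * q) = D p * q + p * D q) \<and>
     (\<forall>r. D (Const r) = 0) \<and>
     (\<forall>v. D (Var v) = f v)"

lemma poly_mapping_additive_induct:
  fixes p :: "'k \<Rightarrow>\<^sub>0 'c::comm_monoid_add"
  assumes single: "\<And>m c. P (Poly_Mapping.single m c)"
    and add: "\<And>p q. P p \<Longrightarrow> P q \<Longrightarrow> P (p + q)"
  shows "P p"
proof (induction p rule: update_induct)
  case const
  show ?case using single[of undefined 0] by simp
next
  case (update p a b)
  have "Poly_Mapping.update a b p = p + Poly_Mapping.single a b"
    using update by (intro poly_mapping_eqI)
      (auto simp: lookup_update lookup_add lookup_single in_keys_iff when_def)
  then show ?case using add single update by simp
qed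

lemma formal_derivative_unique:
  assumes D: "formal_derivative f D" and E: "formal_derivative f E"
  shows "D = E"
proof
  note defs = D[unfolded formal_derivative_def] E[unfolded formal_derivative_def]
  have pow: "D (Poly_Mapping.single (Poly_Mapping.single v n) 1)
      = E (Poly_Mapping.single (Poly_Mapping.single v n) 1)" for v n
  proof (induction n)
    case 0
    have "D (Const 1) = E (Const 1)" using defs by simp
    then show ?case by (simp add: Const_def)
  next
    case (Suc n)
    have "Poly_Mapping.single (Poly_Mapping.single v (Suc n)) (1::rat)
        = Var v * Poly_Mapping.single (Poly_Mapping.single v n) 1"
      by (simp add: Var_def mult_single flip: single_add)
    then show ?case using defs Suc by simp
  qed
  have mon: "D (Poly_Mapping.single m 1) = E (Poly_Mapping.single m 1)" for m
  proof (induction m rule: poly_mapping_additive_induct)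
    case (1 v n)
    show ?case by (rule pow)
  next
    case (2 m k)
    have "Poly_Mapping.single (m + k) (1::rat) = Poly_Mapping.single m 1 * Poly_Mapping.single k 1"
      by (simp add: mult_single)
    then show ?case using defs 2 by simp
  qed
  fix p
  show "D p = E p"
  proof (induction p rule: poly_mapping_additive_induct)
    case (1 m c)
    have "Poly_Mapping.single m c = Const c * Poly_Mapping.single m 1"
      by (simp add: Const_def mult_single)
    then show ?case using defs mon by simp
  next
    case (2 p q)
    then show ?case using defs by simp
  qed
qed

lemma formal_derivative_exists:
  fixes f :: "'v::finite \<Rightarrow> 'v qpoly"
  shows "\<exists>D. formal_derivative f D"
proof -
  define E :: "('v \<Rightarrow>\<^sub>0 nat) \<Rightarrow> 'v qpoly" where
    "E m = (\<Sum>v\<in>UNIV. of_nat (Poly_Mapping.lookup m v)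
      * Poly_Mapping.single (m - Poly_Mapping.single v 1) 1 * f v)" for m
  define D :: "'v qpoly \<Rightarrow> 'v qpoly" where
    "D p = (\<Sum>m\<in>Poly_Mapping.keys p. Const (Poly_Mapping.lookup p m) * E m)" for p
  have Const_add: "Const (r + s) = Const r + (Const s :: 'v qpoly)" for r s
    by (simp add: Const_def single_add)
  have add: "D (p + q) = D p + D q" for p q
    unfolding D_def
    by (rule setsum_keys_plus_distrib) (simp_all add: Const_add distrib_right, simp add: Const_def)
  have single: "D (Poly_Mapping.single m c) = Const c * E m" for m c
    by (cases "c = 0") (simp_all add: D_def Const_def)
  have E_add: "E (m + k) = E m * Poly_Mapping.single k 1 + Poly_Mapping.single m 1 * E k" for m k
  proof -
    have 1: "of_nat (Poly_Mapping.lookup m v) * Poly_Mapping.single (m + k - Poly_Mapping.single v 1) (1::rat)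
      = of_nat (Poly_Mapping.lookup m v) * Poly_Mapping.single (m - Poly_Mapping.single v 1) 1
          * Poly_Mapping.single k 1" for m k v
    proof (cases "Poly_Mapping.lookup m v = 0")
      case False
      then have "m + k - Poly_Mapping.single v 1 = (m - Poly_Mapping.single v 1) + k"
        by (intro poly_mapping_eqI) (auto simp: lookup_add lookup_minus lookup_single when_def)
      then show ?thesis by (simp add: mult_single mult.assoc)
    qed simp
    have "of_nat (Poly_Mapping.lookup (m + k) v) * Poly_Mapping.single (m + k - Poly_Mapping.single v 1) 1 * f v
      = of_nat (Poly_Mapping.lookup m v) * Poly_Mapping.single (m - Poly_Mapping.single v 1) 1 * f v
          * Poly_Mapping.single k 1
        + Poly_Mapping.single m 1
          * (of_nat (Poly_Mapping.lookup k v) * Poly_Mapping.single (k - Poly_Mapping.single v 1) 1 * f v)" for v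
      unfolding lookup_add of_nat_add distrib_right 1[of m v k]
        1[of k v m, unfolded add.commute[of k m]]
      by (simp only: mult_ac)
    then show ?thesis
      unfolding E_def by (simp add: sum.distrib sum_distrib_left sum_distrib_right)
  qed
  have Leibniz: "D (p * q) = D p * q + p * D q" for p q
  proof (induction p rule: poly_mapping_additive_induct)
    case (1 m c)
    show ?case
    proof (induction q rule: poly_mapping_additive_induct)
      case (1 k d)
      have s: "Poly_Mapping.single l e = Const e * Poly_Mapping.single l 1"
        for l :: "'v \<Rightarrow>\<^sub>0 nat" and e by (simp add: Const_def mult_single)
      have c: "Const (c * d) = Const c * (Const d :: 'v qpoly)"
        by (simp add: Const_def mult_single)
      have "D (Poly_Mapping.single m c * Poly_Mapping.single k d) = Const (c * d) * E (m + k)"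
        by (simp add: mult_single single)
      then show ?case
        unfolding single E_add c by (subst s[of m c], subst s[of k d]) (simp add: algebra_simps)
    next
      case (2 p q)
      then show ?case by (simp add: add algebra_simps)
    qed
  next
    case (2 p q)
    then show ?case by (simp add: add algebra_simps)
  qed
  have E0: "E 0 = 0" by (simp add: E_def)
  have const: "D (Const r) = 0" for r
    using single[of 0 r] by (simp add: E0 Const_def)
  have scale: "D (Const r * p) = Const r * D p" for r p
    by (simp add: Leibniz const)
  have "E (Poly_Mapping.single v 1) = f v" for v
  proof -
    have "E (Poly_Mapping.single v 1) = (\<Sum>w\<in>UNIV. if w = v then f w else 0)"
      unfolding E_def by (intro sum.cong) (auto simp: lookup_single when_def)
    then show ?thesis by simp
  qed
  then have var: "D (Var v) = f v" for v
    by (simp add: Var_def single) (simp add: Const_def)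
  show ?thesis
    unfolding formal_derivative_def using add scale Leibniz const var by blast
qed

lemma formal_derivative_ex1:
  fixes f :: "'v::finite \<Rightarrow> 'v qpoly"
  shows "\<exists>!D. formal_derivative f D"
  using formal_derivative_exists formal_derivative_unique by blast

datatype letter = a | b | c | d | t

instance letter :: finite
proof
  have "(UNIV :: letter set) = {a, b, c, d, t}"
    using letter.exhaust by auto
  then show "finite (UNIV :: letter set)"
    by (metis finite.emptyI finite_insert)
qed

hide_const (open) a b c d t

abbreviation "va \<equiv> Var letter.a"
abbreviation "vb \<equiv> Var letter.b"
abbreviation "vc \<equiv> Var letter.c"
abbreviation "vd \<equiv> Var letter.d"
abbreviation "vt \<equiv> Var letter.t"

fun grammar :: "letter \<Rightarrow> letter qpoly" where
  "grammar letter.a = 3 * vt * (va * vd + vb * vc)"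
| "grammar letter.b = 3 * vt * (va * vd + vb * vc)"
| "grammar letter.c = 2 * va"
| "grammar letter.d = 2 * vb"
| "grammar letter.t = vt ^ 2 * (vc + vd)"

datatype plane_tree = Node "plane_tree list"

text \<open>
  A vertex is represented by its address, the list of (0-based) positions among siblings on the path
  from the root \<open>[]\<close> down to it. So the parent of \<open>u @ [i]\<close> is \<open>u\<close>, and the children of a vertex
  are ordered from left to right by their last index.
\<close>

lemma size_nth_less [termination_simp]:
  fixes ts :: "plane_tree list"
  shows "i < length ts \<Longrightarrow> size (ts ! i) < Suc (size_list size ts)"
  by (rule le_imp_less_Suc[OF size_list_estimation'[OF nth_mem order_refl]])

fun vertices :: "plane_tree \<Rightarrow> nat list set" where
  "vertices (Node ts) = insert [] (\<Union>i\<in>{..<length ts}. (#) i ` vertices (ts ! i))"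

definition children :: "plane_tree \<Rightarrow> nat list \<Rightarrow> nat list set" where
  "children T u = {v \<in> vertices T. \<exists>i. v = u @ [i]}"

definition edges :: "plane_tree \<Rightarrow> (nat list \<times> nat list) set" where
  "edges T = {(u, v). u \<in> vertices T \<and> v \<in> children T u}"

definition plane_trees :: "nat \<Rightarrow> plane_tree set" where
  "plane_trees n = {T. card (edges T) = n}"

definition siblings :: "plane_tree \<Rightarrow> nat list \<Rightarrow> nat list set" where
  "siblings T v = {w. w \<noteq> v \<and> (\<exists>u\<in>vertices T. v \<in> children T u \<and> w \<in> children T u)}"

definition leftmost_child :: "plane_tree \<Rightarrow> nat list \<Rightarrow> bool" where
  "leftmost_child T v \<longleftrightarrow> (\<exists>u\<in>vertices T. v \<in> children T u \<and> (\<forall>w\<in>children T u. last v \<le> last w))"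

definition leaves :: "plane_tree \<Rightarrow> nat list set" where
  "leaves T = {v \<in> vertices T. children T v = {}}"

definition interiors :: "plane_tree \<Rightarrow> nat list set" where
  "interiors T = {v \<in> vertices T. children T v \<noteq> {}}"

definition singleton_leaves :: "plane_tree \<Rightarrow> nat list set" where
  "singleton_leaves T = {v \<in> leaves T. siblings T v = {}}"

definition elder_leaves :: "plane_tree \<Rightarrow> nat list set" where
  "elder_leaves T = {v \<in> leaves T. siblings T v \<noteq> {} \<and> leftmost_child T v}"

definition young_leaves :: "plane_tree \<Rightarrow> nat list set" where
  "young_leaves T = {v \<in> leaves T. siblings T v \<noteq> {} \<and> \<not> leftmost_child T v}"

definition young_interiors :: "plane_tree \<Rightarrow> nat list set" where
  "young_interiors T =
     {u \<in> interiors T. children T u \<inter> (singleton_leaves T \<union> elder_leaves T) = {}}"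

definition young_edges :: "plane_tree \<Rightarrow> (nat list \<times> nat list) set" where
  "young_edges T = {(u, v) \<in> edges T. v \<notin> singleton_leaves T \<union> elder_leaves T}"

definition "sleaf T = card (singleton_leaves T)"
definition "eleaf T = card (elder_leaves T)"
definition "yleaf T = card (young_leaves T)"
definition "yint T = card (young_interiors T)"
definition "yedge T = card (young_edges T)"

definition Gtilde :: "nat \<Rightarrow> 'r \<Rightarrow> 'r \<Rightarrow> 'r \<Rightarrow> 'r \<Rightarrow> 'r \<Rightarrow> 'r::comm_semiring_1" where
  "Gtilde n a b c d t =
     (\<Sum>T\<in>plane_trees n. a ^ sleaf T * b ^ eleaf T * c ^ yleaf T * d ^ yint T * t ^ yedge T)"

end

theory Submission
  imports Defs "HOL-Computational_Algebra.Formal_Power_Series"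
begin

text \<open>
  Let \<open>W = \<Sum>\<^sub>n\<^sub>\<ge>\<^sub>1 G\<^sub>n x\<^sup>n\<close>. Splitting off the leftmost branch of the root, and with \<open>\<Phi>\<close> the
  generating function of sequences of branches that are not leftmost, one gets
  \<open>\<Phi> = 1 + x t (c + W) \<Phi>\<close> and \<open>W = x (a + b (\<Phi> - 1) + d t W \<Phi>)\<close>. Eliminating \<open>\<Phi>\<close> leaves a quadratic
  equation \<open>P(W) = 0\<close>, namely
  \<open>t x W\<^sup>2 + (t x (c + d) - 1 + t x\<^sup>2 (b - a)) W + x a + t x\<^sup>2 c (b - a) = 0\<close>.
  Applying the derivation \<open>\<Delta> = x D - x d/dx\<close> to it gives
  \<open>P'(W) (\<Delta> W - W + 2 a x) = - (1 + t x (c + d)) P(W) = 0\<close>, and \<open>P'(W)\<close> has constant term \<open>-1\<close>.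
  So \<open>\<Delta> W = W - 2 a x\<close>, that is \<open>D G\<^sub>n = (n + 2) G\<^sub>n\<^sub>+\<^sub>1\<close> for \<open>n \<ge> 1\<close>. As \<open>D d = 2 b\<close>,
  \<open>D b = D a\<close> and \<open>G\<^sub>1 = a\<close>, the theorem follows by induction.
\<close>

section \<open>Addresses, children, siblings and leftmost children, seen from a branch at the
  root\<close>

lemma Nil_in_vertices [simp]: "[] \<in> vertices T"
  by (cases T) auto

lemma finite_vertices [simp]: "finite (vertices T)"
  by (induction T rule: vertices.induct) auto

lemma Cons_in_vertices [simp]:
  "i # v \<in> vertices (Node ts) \<longleftrightarrow> i < length ts \<and> v \<in> vertices (ts ! i)"
  by auto

lemma vertices_parent: "u @ [i] \<in> vertices T \<Longrightarrow> u \<in> vertices T"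
proof (induction u arbitrary: T)
  case (Cons j u)
  then show ?case by (cases T) (auto simp del: vertices.simps)
qed simp

declare vertices.simps [simp del]

lemma children_alt: "children T u = {u @ [i] |i. u @ [i] \<in> vertices T}"
  by (auto simp: children_def)

lemma children_Nil [simp]: "children (Node ts) [] = {[i] |i. i < length ts}"
  by (auto simp: children_alt)

lemma children_Cons [simp]:
  "i < length ts \<Longrightarrow> children (Node ts) (i # u) = (#) i ` children (ts ! i) u"
  by (auto simp: children_alt)

lemma children_Nil_empty_iff: "children T [] = {} \<longleftrightarrow> T = Node []"
  by (cases T) (auto intro: exI[of _ 0])

lemma siblings_Nil [simp]: "siblings T [] = {}"
  by (auto simp: siblings_def children_alt)

lemma siblings_snoc:
  "u @ [i] \<in> vertices T \<Longrightarrow> siblings T (u @ [i]) = children T u - {u @ [i]}"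
  by (auto simp: siblings_def children_alt intro: vertices_parent)

lemma siblings_single [simp]:
  "i < length ts \<Longrightarrow> siblings (Node ts) [i] = {[j] |j. j < length ts \<and> j \<noteq> i}"
  using siblings_snoc[of "[]" i "Node ts"] by auto

text \<open>A vertex other than the root of its branch has its parent inside that branch, so its
  siblings stay the same. The root of a branch must be excluded: it has no siblings within the
  branch but may gain some in the whole tree. The same distinction governs
  \<open>leftmost_child_Cons\<close>.\<close>

lemma siblings_Cons [simp]:
  assumes "i < length ts" "v \<in> vertices (ts ! i)" "v \<noteq> []"
  shows "siblings (Node ts) (i # v) = (#) i ` siblings (ts ! i) v"
proof -
  obtain u j where v: "v = u @ [j]" using assms(3) by (metis rev_exhaust)
  show ?thesis
    using siblings_snoc[of "i # u" j "Node ts"] siblings_snoc[of u j "ts ! i"] assms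
    by (auto simp: v)
qed

lemma leftmost_child_Nil [simp]: "\<not> leftmost_child T []"
  by (auto simp: leftmost_child_def children_alt)

lemma leftmost_child_snoc:
  "u @ [i] \<in> vertices T \<Longrightarrow> leftmost_child T (u @ [i]) \<longleftrightarrow> (\<forall>w\<in>children T u. i \<le> last w)"
  by (auto simp: leftmost_child_def children_alt intro: vertices_parent)

lemma leftmost_child_single [simp]:
  "i < length ts \<Longrightarrow> leftmost_child (Node ts) [i] \<longleftrightarrow> i = 0"
  using leftmost_child_snoc[of "[]" i "Node ts"] by (cases ts) force+

lemma leftmost_child_Cons [simp]:
  assumes "i < length ts" "v \<in> vertices (ts ! i)" "v \<noteq> []"
  shows "leftmost_child (Node ts) (i # v) \<longleftrightarrow> leftmost_child (ts ! i) v"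
proof -
  obtain u j where v: "v = u @ [j]" using assms(3) by (metis rev_exhaust)
  show ?thesis
    using leftmost_child_snoc[of "i # u" j "Node ts"] leftmost_child_snoc[of u j "ts ! i"] assms
    by (auto simp: v children_alt)
qed

section \<open>Recursions for the edge count and the statistics, branch by branch\<close>

lemma card_vertices_Node:
  "card {v \<in> vertices (Node ts). R v} =
     of_bool (R []) + (\<Sum>i<length ts. card {v \<in> vertices (ts ! i). R (i # v)})"
proof -
  have "{v \<in> vertices (Node ts). R v} = (if R [] then {[]} else {}) \<union>
      (\<Union>i\<in>{..<length ts}. (#) i ` {v \<in> vertices (ts ! i). R (i # v)})" (is "_ = ?A \<union> ?B")
    by (auto simp: vertices.simps)
  moreover have "card (?A \<union> ?B) = card ?A + card ?B"
    by (intro card_Un_disjoint) auto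
  moreover have "card ?B = (\<Sum>i<length ts. card ((#) i ` {v \<in> vertices (ts ! i). R (i # v)}))"
    by (intro card_UN_disjoint) auto
  moreover have "\<dots> = (\<Sum>i<length ts. card {v \<in> vertices (ts ! i). R (i # v)})"
    by (intro sum.cong refl card_image) auto
  ultimately show ?thesis by simp
qed

lemma card_vertices_root:
  "card {v \<in> vertices T. R v} = of_bool (R []) + card {v \<in> vertices T. v \<noteq> [] \<and> R v}"
proof -
  have "{v \<in> vertices T. R v} = (if R [] then {[]} else {}) \<union> {v \<in> vertices T. v \<noteq> [] \<and> R v}"
    (is "_ = ?A \<union> ?B") by auto
  moreover have "card (?A \<union> ?B) = card ?A + card ?B"
    by (intro card_Un_disjoint) auto
  ultimately show ?thesis by simp
qed

lemma card_proper_vertices_Node: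
  assumes "\<And>i v. \<lbrakk>i < length ts; v \<in> vertices (ts ! i); v \<noteq> []\<rbrakk> \<Longrightarrow> R (i # v) \<longleftrightarrow> Q (ts ! i) v"
  shows "card {v \<in> vertices (Node ts). v \<noteq> [] \<and> R v} =
     (\<Sum>i<length ts. of_bool (R [i]) + card {v \<in> vertices (ts ! i). v \<noteq> [] \<and> Q (ts ! i) v})"
proof -
  have "{v \<in> vertices (ts ! i). v \<noteq> [] \<and> R (i # v)} = {v \<in> vertices (ts ! i). v \<noteq> [] \<and> Q (ts ! i) v}"
    if "i < length ts" for i using assms[OF that] by blast
  then show ?thesis
    by (auto simp: card_vertices_Node card_vertices_root[of _ "\<lambda>v. R (_ # v)"] intro!: sum.cong)
qed

text \<open>Common source of most recursions below. A statistic changes its local meaning only at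
  the roots of the branches: strictly inside a branch it is the intrinsic property \<open>Q\<close>,
  and at the later branches it depends only on the branch, through \<open>P\<close>. The value at
  \<open>[0]\<close> stays open, because the first child decides between singleton, elder and no old
  leaf.\<close>

lemma card_proper_vertices_Cons:
  assumes sub: "\<And>i v. \<lbrakk>i < length (s # r); v \<in> vertices ((s # r) ! i); v \<noteq> []\<rbrakk>
        \<Longrightarrow> R (i # v) \<longleftrightarrow> Q ((s # r) ! i) v"
    and child: "\<And>i. i < length r \<Longrightarrow> R [Suc i] \<longleftrightarrow> P (r ! i)"
    and N: "\<And>x. N x = card {v \<in> vertices x. v \<noteq> [] \<and> Q x v}"
  shows "card {v \<in> vertices (Node (s # r)). v \<noteq> [] \<and> R v} =
     of_bool (R [0]) + N s + (\<Sum>x\<leftarrow>r. of_bool (P x) + N x)"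
proof -
  have "card {v \<in> vertices (Node (s # r)). v \<noteq> [] \<and> R v} =
      (\<Sum>i<Suc (length r). of_bool (R [i]) + N ((s # r) ! i))"
    by (subst card_proper_vertices_Node[of "s # r" R Q]) (use sub in \<open>simp_all only: N length_Cons\<close>)
  also have "\<dots> = of_bool (R [0]) + N s + (\<Sum>i<length r. of_bool (P (r ! i)) + N (r ! i))"
    by (subst sum.lessThan_Suc_shift) (simp add: child)
  also have "(\<Sum>i<length r. of_bool (P (r ! i)) + N (r ! i)) = (\<Sum>x\<leftarrow>r. of_bool (P x) + N x)"
    by (simp add: sum_list_sum_nth atLeast0LessThan)
  finally show ?thesis .
qed

text \<open>Since the root has no siblings, \<open>sleaf (Node []) = 1\<close>; excluding the root makes the
  statistic additive over the branches at the root.\<close>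

definition proper_sleaf :: "plane_tree \<Rightarrow> nat" where
  "proper_sleaf T = card {v \<in> vertices T. v \<noteq> [] \<and> children T v = {} \<and> siblings T v = {}}"

lemma proper_sleaf_Node_Cons:
  "proper_sleaf (Node (s # r)) =
     of_bool (s = Node [] \<and> r = []) + proper_sleaf s + sum_list (map proper_sleaf r)"
proof -
  have "proper_sleaf (Node (s # r)) =
      of_bool (children (Node (s # r)) [0] = {} \<and> siblings (Node (s # r)) [0] = {})
      + proper_sleaf s + (\<Sum>x\<leftarrow>r. of_bool False + proper_sleaf x)"
    unfolding proper_sleaf_def[of "Node (s # r)"]
    by (rule card_proper_vertices_Cons[where Q = "\<lambda>T v. children T v = {} \<and> siblings T v = {}"])
      (auto simp: proper_sleaf_def)
  then show ?thesis by (auto simp: children_Nil_empty_iff)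
qed

lemma eleaf_alt: "eleaf T = card {v \<in> vertices T. v \<noteq> [] \<and>
    children T v = {} \<and> siblings T v \<noteq> {} \<and> leftmost_child T v}"
  unfolding eleaf_def elder_leaves_def leaves_def
  by (intro arg_cong[where f = card]) auto

lemma eleaf_Node_Cons:
  "eleaf (Node (s # r)) = of_bool (s = Node [] \<and> r \<noteq> []) + eleaf s + sum_list (map eleaf r)"
proof -
  have "eleaf (Node (s # r)) =
      of_bool (children (Node (s # r)) [0] = {} \<and> siblings (Node (s # r)) [0] \<noteq> {}
        \<and> leftmost_child (Node (s # r)) [0])
      + eleaf s + (\<Sum>x\<leftarrow>r. of_bool False + eleaf x)"
    unfolding eleaf_alt[of "Node (s # r)"]
    by (rule card_proper_vertices_Cons[where Q = "\<lambda>T v. children T v = {} \<and>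
        siblings T v \<noteq> {} \<and> leftmost_child T v"])
      (auto simp: eleaf_alt)
  then show ?thesis by (auto simp: children_Nil_empty_iff)
qed

lemma yleaf_alt: "yleaf T = card {v \<in> vertices T. v \<noteq> [] \<and>
    children T v = {} \<and> siblings T v \<noteq> {} \<and> \<not> leftmost_child T v}"
  unfolding yleaf_def young_leaves_def leaves_def
  by (intro arg_cong[where f = card]) auto

lemma yleaf_Node_Cons:
  "yleaf (Node (s # r)) = yleaf s + (\<Sum>x\<leftarrow>r. of_bool (x = Node []) + yleaf x)"
proof -
  have "yleaf (Node (s # r)) =
      of_bool (children (Node (s # r)) [0] = {} \<and> siblings (Node (s # r)) [0] \<noteq> {}
        \<and> \<not> leftmost_child (Node (s # r)) [0])
      + yleaf s + (\<Sum>x\<leftarrow>r. of_bool (x = Node []) + yleaf x)"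
    unfolding yleaf_alt[of "Node (s # r)"]
    by (rule card_proper_vertices_Cons[where Q = "\<lambda>T v. children T v = {} \<and>
        siblings T v \<noteq> {} \<and> \<not> leftmost_child T v"])
      (auto simp: yleaf_alt children_Nil_empty_iff)
  then show ?thesis by auto
qed

text \<open>Merges singleton and elder leaves, since young edges and young interior vertices are
  both defined by avoiding their union. It also holds for the root of the one-vertex tree.\<close>

definition old_leaf :: "plane_tree \<Rightarrow> nat list \<Rightarrow> bool" where
  "old_leaf T v \<longleftrightarrow> children T v = {} \<and> (siblings T v = {} \<or> leftmost_child T v)"

lemma old_leaves: "singleton_leaves T \<union> elder_leaves T = {v \<in> vertices T. old_leaf T v}"
  by (auto simp: singleton_leaves_def elder_leaves_def leaves_def old_leaf_def)

text \<open>The child \<open>[0]\<close> is leftmost, so it is old as soon as it is a leaf; any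
  other child has the sibling \<open>[0]\<close> and is not leftmost.\<close>

lemma old_leaf_single:
  "i < length ts \<Longrightarrow> old_leaf (Node ts) [i] \<longleftrightarrow> i = 0 \<and> ts ! 0 = Node []"
  by (cases "i = 0") (auto simp: old_leaf_def children_Nil_empty_iff intro: exI[of _ 0])

lemma old_leaf_Cons:
  "\<lbrakk>i < length ts; v \<in> vertices (ts ! i); v \<noteq> []\<rbrakk>
     \<Longrightarrow> old_leaf (Node ts) (i # v) \<longleftrightarrow> old_leaf (ts ! i) v"
  by (simp add: old_leaf_def)

lemma edges_alt: "edges T = {(u, u @ [i]) |u i. u @ [i] \<in> vertices T}"
  by (auto simp: edges_def children_alt intro: vertices_parent)

text \<open>Every vertex except the root is the lower endpoint of exactly one edge, so
  \<open>snd\<close> turns counts of edges into counts of proper vertices.\<close>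

lemma card_edges_snd:
  "card {(u, v) \<in> edges T. R v} = card {v \<in> vertices T. v \<noteq> [] \<and> R v}"
proof (rule bij_betw_same_card)
  show "bij_betw snd {(u, v) \<in> edges T. R v} {v \<in> vertices T. v \<noteq> [] \<and> R v}"
    unfolding bij_betw_def inj_on_def edges_alt
    by (auto simp: image_iff) (metis rev_exhaust)
qed

lemma card_edges_Node_Cons:
  "card (edges (Node (s # r))) =
     Suc (card (edges s)) + (\<Sum>x\<leftarrow>r. Suc (card (edges x)))"
proof -
  have E: "card (edges T) = card {v \<in> vertices T. v \<noteq> [] \<and> True}" for T
    using card_edges_snd[of T "\<lambda>_. True"] by simp
  have "card (edges (Node (s # r))) = of_bool True + card (edges s) +
      (\<Sum>x\<leftarrow>r. of_bool True + card (edges x))"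
    unfolding E[of "Node (s # r)"]
    by (rule card_proper_vertices_Cons[where Q = "\<lambda>_ _. True"]) (auto simp: E)
  then show ?thesis by simp
qed

lemma yedge_alt: "yedge T = card {v \<in> vertices T. v \<noteq> [] \<and> \<not> old_leaf T v}"
proof -
  have "young_edges T = {(u, v) \<in> edges T. \<not> old_leaf T v}"
    unfolding young_edges_def old_leaves by (auto simp: edges_alt)
  then show ?thesis by (simp add: yedge_def card_edges_snd)
qed

lemma yedge_Node_Cons:
  "yedge (Node (s # r)) = of_bool (s \<noteq> Node []) + yedge s + (\<Sum>x\<leftarrow>r. Suc (yedge x))"
proof -
  have "yedge (Node (s # r)) = of_bool (\<not> old_leaf (Node (s # r)) [0]) + yedge s +
      (\<Sum>x\<leftarrow>r. of_bool True + yedge x)"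
    unfolding yedge_alt[of "Node (s # r)"]
    by (rule card_proper_vertices_Cons[where Q = "\<lambda>T v. \<not> old_leaf T v"])
      (auto simp: yedge_alt old_leaf_single old_leaf_Cons)
  then show ?thesis by (simp add: old_leaf_single)
qed

lemma yint_alt: "yint T = card {u \<in> vertices T. children T u \<noteq> {} \<and> (\<forall>v\<in>children T u. \<not> old_leaf T v)}"
  unfolding yint_def young_interiors_def old_leaves interiors_def
  by (intro arg_cong[where f = card]) (auto simp: children_def)

text \<open>Being a young interior vertex is a condition on the children of a vertex, so it is
  intrinsic to a branch even at the root of that branch. Only the root of the whole tree adds a
  term, and of its children only the first can be an old leaf.\<close>

lemma yint_Node_Cons:
  "yint (Node (s # r)) = of_bool (s \<noteq> Node []) + yint s + sum_list (map yint r)"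
proof -
  let ?T = "Node (s # r)"
  have sub: "(children ?T (i # u) \<noteq> {} \<and> (\<forall>v\<in>children ?T (i # u). \<not> old_leaf ?T v)) \<longleftrightarrow>
      children ((s # r) ! i) u \<noteq> {} \<and>
      (\<forall>v\<in>children ((s # r) ! i) u. \<not> old_leaf ((s # r) ! i) v)"
    if "i < length (s # r)" for i u
    using that by (auto simp: children_alt old_leaf_Cons)
  have "(\<forall>v\<in>children ?T []. \<not> old_leaf ?T v) \<longleftrightarrow> s \<noteq> Node []"
    by (auto simp: old_leaf_single)
  then have "yint ?T = of_bool (s \<noteq> Node []) + (\<Sum>i<Suc (length r). yint ((s # r) ! i))"
    unfolding yint_alt card_vertices_Node using sub
    by (auto intro!: arg_cong2[where f = "(+)"] sum.cong arg_cong[where f = card])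
  also have "(\<Sum>i<Suc (length r). yint ((s # r) ! i)) = yint s + sum_list (map yint r)"
    by (subst sum.lessThan_Suc_shift) (simp add: sum_list_sum_nth atLeast0LessThan)
  finally show ?thesis by simp
qed

lemma statistics_single_vertex [simp]:
  "proper_sleaf (Node []) = 0" "eleaf (Node []) = 0" "yleaf (Node []) = 0"
  "yint (Node []) = 0" "yedge (Node []) = 0" "card (edges (Node [])) = 0"
  by (simp_all add: proper_sleaf_def eleaf_alt yleaf_alt yint_alt yedge_alt edges_alt vertices.simps)

lemma sleaf_eq_proper_sleaf: "T \<noteq> Node [] \<Longrightarrow> sleaf T = proper_sleaf T"
  unfolding sleaf_def proper_sleaf_def singleton_leaves_def leaves_def
  using children_Nil_empty_iff[of T] by (intro arg_cong[where f = card]) auto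

section \<open>Forests of branches, graded by the number of edges\<close>

definition forest_size :: "plane_tree list \<Rightarrow> nat" where
  "forest_size ts = (\<Sum>x\<leftarrow>ts. Suc (card (edges x)))"

definition forests :: "nat \<Rightarrow> plane_tree list set" where
  "forests n = {ts. forest_size ts = n}"

lemma card_edges_Node: "card (edges (Node ts)) = forest_size ts"
  by (cases ts) (simp_all add: forest_size_def card_edges_Node_Cons)

lemma plane_trees_eq_image: "plane_trees n = Node ` forests n"
proof -
  have "T \<in> Node ` forests n" if "card (edges T) = n" for T
    using that by (cases T) (simp add: card_edges_Node forests_def)
  then show ?thesis by (auto simp: plane_trees_def forests_def card_edges_Node)
qed

lemma forests_0: "forests 0 = {[]}"
proof -
  have "forest_size ts = 0 \<longleftrightarrow> ts = []" for ts by (cases ts) (simp_all add: forest_size_def)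
  then show ?thesis by (auto simp: forests_def)
qed

lemma plane_trees_0: "plane_trees 0 = {Node []}"
  by (simp add: plane_trees_eq_image forests_0)

text \<open>A first branch with \<open>k\<close> edges uses \<open>k + 1\<close> edges together with
  the edge above it, which leaves \<open>m - k\<close> for the rest.\<close>

lemma forests_Suc:
  "forests (Suc m) = (\<lambda>(k, s, r). s # r) ` (SIGMA k:{..m}. plane_trees k \<times> forests (m - k))"
proof (intro equalityI subsetI)
  fix ts assume ts: "ts \<in> forests (Suc m)"
  then obtain s r where "ts = s # r" by (cases ts) (auto simp: forests_def forest_size_def)
  then show "ts \<in> (\<lambda>(k, s, r). s # r) ` (SIGMA k:{..m}. plane_trees k \<times> forests (m - k))"
    using ts by (auto simp: forests_def forest_size_def plane_trees_def
        intro!: image_eqI[of _ _ "(card (edges s), s, r)"])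
qed (auto simp: forests_def forest_size_def plane_trees_def)

lemma finite_forests: "finite (forests n)"
proof (induction n rule: less_induct)
  case (less n)
  then show ?case
    by (cases n) (auto simp: forests_0 forests_Suc plane_trees_eq_image less_Suc_eq_le
        intro!: finite_imageI finite_SigmaI)
qed

lemma finite_plane_trees: "finite (plane_trees n)"
  by (simp add: plane_trees_eq_image finite_forests)

lemma sum_forests_Suc:
  "(\<Sum>ts\<in>forests (Suc m). f ts) =
     (\<Sum>k\<le>m. \<Sum>s\<in>plane_trees k. \<Sum>r\<in>forests (m - k). f (s # r))"
proof -
  \<comment> \<open>The index \<open>k\<close> is recovered from \<open>s\<close> as its number of
    edges.\<close>
  have "inj_on (\<lambda>(k, s, r). s # r) (SIGMA k:{..m}. plane_trees k \<times> forests (m - k))"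
    by (auto simp: inj_on_def plane_trees_def)
  then show ?thesis
    by (simp add: forests_Suc sum.reindex o_def case_prod_unfold sum.Sigma
        finite_plane_trees finite_forests)
qed

section \<open>Weights, generating functions and the quadratic equation\<close>

context
  fixes a b c d t :: "'r::comm_ring_1"
begin

definition tree_weight :: "plane_tree \<Rightarrow> 'r" where
  "tree_weight T = a ^ proper_sleaf T * b ^ eleaf T * c ^ yleaf T * d ^ yint T * t ^ yedge T"

text \<open>Weight of a branch that is not leftmost, including the edge above it: that edge is
  always young, hence \<open>t\<close>, and a branch consisting of one vertex is a young leaf, hence
  \<open>c\<close>.\<close>

definition branch_weight :: "plane_tree \<Rightarrow> 'r" where
  "branch_weight T = t * c ^ of_bool (T = Node []) * tree_weight T"

lemma tree_weight_single_vertex [simp]: "tree_weight (Node []) = 1"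
  by (simp add: tree_weight_def)

lemma prod_branch_weight:
  "(\<Prod>x\<leftarrow>r. branch_weight x) =
     a ^ sum_list (map proper_sleaf r) * b ^ sum_list (map eleaf r) *
     c ^ (\<Sum>x\<leftarrow>r. of_bool (x = Node []) + yleaf x) * d ^ sum_list (map yint r) *
     t ^ (\<Sum>x\<leftarrow>r. Suc (yedge x))"
  by (induction r) (simp_all add: branch_weight_def tree_weight_def power_add mult_ac)

text \<open>If the first branch is a single vertex, it is a singleton leaf (\<open>a\<close>) or an
  elder leaf (\<open>b\<close>), and neither the root nor the edge between them is young. Otherwise
  the root is a young interior vertex (\<open>d\<close>) and the edge to the first branch is young
  (\<open>t\<close>).\<close>

lemma tree_weight_Node_Cons:
  "tree_weight (Node (s # r)) =
     (if s = Node [] then if r = [] then a else b else d * t * tree_weight s)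
     * (\<Prod>x\<leftarrow>r. branch_weight x)"
  by (auto simp: tree_weight_def prod_branch_weight proper_sleaf_Node_Cons eleaf_Node_Cons
      yleaf_Node_Cons yint_Node_Cons yedge_Node_Cons power_add mult_ac)

lemma Gtilde_eq_sum_tree_weight:
  "n > 0 \<Longrightarrow> Gtilde n a b c d t = (\<Sum>T\<in>plane_trees n. tree_weight T)"
  unfolding Gtilde_def tree_weight_def
  by (intro sum.cong refl arg_cong2[where f = "(*)"] arg_cong[where f = "power a"]
      sleaf_eq_proper_sleaf) (auto simp: plane_trees_def)

text \<open>The constant term is 0 because the single vertex is treated separately: it enters as
  \<open>c\<close> in \<open>branch_gf\<close> and as \<open>a\<close> or \<open>b\<close> in
  \<open>tree_gf_eq\<close>.\<close>

definition tree_gf :: "'r fps" where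
  "tree_gf = Abs_fps (\<lambda>n. if n = 0 then 0 else Gtilde n a b c d t)"

definition branch_gf :: "'r fps" where
  "branch_gf = fps_const t * (fps_const c + tree_gf)"

definition forest_gf :: "'r fps" where
  "forest_gf = Abs_fps (\<lambda>n. \<Sum>ts\<in>forests n. \<Prod>x\<leftarrow>ts. branch_weight x)"

lemma sum_branch_weight: "(\<Sum>s\<in>plane_trees k. branch_weight s) = fps_nth branch_gf k"
proof (cases "k = 0")
  case True
  then show ?thesis
    by (simp add: plane_trees_0 branch_gf_def tree_gf_def branch_weight_def)
next
  case False
  then have "(\<Sum>s\<in>plane_trees k. branch_weight s) = (\<Sum>s\<in>plane_trees k. t * tree_weight s)"
    by (intro sum.cong refl) (auto simp: branch_weight_def plane_trees_def)
  then show ?thesis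
    using False by (simp add: branch_gf_def tree_gf_def Gtilde_eq_sum_tree_weight sum_distrib_left)
qed

text \<open>A forest is empty or a branch followed by a forest; the factor \<open>fps_X\<close>
  marks the edge above that branch.\<close>

lemma forest_gf_eq: "forest_gf = 1 + fps_X * (branch_gf * forest_gf)"
proof (rule fps_ext)
  fix n
  show "fps_nth forest_gf n = fps_nth (1 + fps_X * (branch_gf * forest_gf)) n"
  proof (cases n)
    case 0
    then show ?thesis by (simp add: forest_gf_def forests_0)
  next
    case (Suc m)
    have "fps_nth forest_gf n =
        (\<Sum>k\<le>m. fps_nth branch_gf k * fps_nth forest_gf (m - k))"
      using Suc by (simp add: forest_gf_def sum_forests_Suc sum_product flip: sum_branch_weight)
    also have "\<dots> = fps_nth (branch_gf * forest_gf) m"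
      by (simp add: fps_mult_nth atLeast0AtMost)
    finally show ?thesis using Suc by simp
  qed
qed

lemma tree_gf_eq:
  "tree_gf = fps_X * (fps_const a + fps_const b * (forest_gf - 1)
     + fps_const (d * t) * (tree_gf * forest_gf))"
    (is "_ = fps_X * (?first_leaf + _)")
proof (rule fps_ext)
  fix n
  show "fps_nth tree_gf n = fps_nth (fps_X * (?first_leaf
      + fps_const (d * t) * (tree_gf * forest_gf))) n"
  proof (cases n)
    case 0
    then show ?thesis by (simp add: tree_gf_def)
  next
    case (Suc m)
    \<comment> \<open>Here \<open>k\<close> is the number of edges of the first branch. For
      \<open>k = 0\<close> the second term vanishes, since \<open>tree_gf\<close> has constant term
      0.\<close>
    have summand: "(\<Sum>s\<in>plane_trees k. \<Sum>r\<in>forests (m - k). tree_weight (Node (s # r))) =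
        (if k = 0 then fps_nth ?first_leaf m else 0)
        + d * t * (fps_nth tree_gf k * fps_nth forest_gf (m - k))" for k
    proof (cases "k = 0")
      case True
      \<comment> \<open>The coefficient at 0 is \<open>a\<close>, from the empty forest alone; for
        \<open>m > 0\<close> every forest is nonempty, and subtracting 1 from
        \<open>forest_gf\<close> does not affect the coefficient.\<close>
      have "(\<Sum>r\<in>forests m. (if r = [] then a else b) * (\<Prod>x\<leftarrow>r. branch_weight x)) =
          fps_nth ?first_leaf m"
      proof (cases m)
        case (Suc l)
        have "(\<Sum>r\<in>forests m. (if r = [] then a else b) * (\<Prod>x\<leftarrow>r. branch_weight x)) =
            (\<Sum>r\<in>forests m. b * (\<Prod>x\<leftarrow>r. branch_weight x))"
          using Suc by (intro sum.cong refl) (auto simp: forests_def forest_size_def)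
        then show ?thesis using Suc by (simp add: forest_gf_def sum_distrib_left)
      qed (simp add: forests_0 forest_gf_def)
      then show ?thesis using True
        by (simp add: plane_trees_0 tree_weight_Node_Cons tree_gf_def)
    next
      case False
      then have "(\<Sum>s\<in>plane_trees k. \<Sum>r\<in>forests (m - k). tree_weight (Node (s # r))) =
          (\<Sum>s\<in>plane_trees k. \<Sum>r\<in>forests (m - k).
             d * t * (tree_weight s * (\<Prod>x\<leftarrow>r. branch_weight x)))"
        by (intro sum.cong refl) (auto simp: tree_weight_Node_Cons plane_trees_def mult_ac)
      also have "\<dots> = d * t * ((\<Sum>s\<in>plane_trees k. tree_weight s) *
          (\<Sum>r\<in>forests (m - k). \<Prod>x\<leftarrow>r. branch_weight x))"
        unfolding sum_product by (simp only: sum_distrib_left)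
      finally show ?thesis
        using False by (simp add: tree_gf_def forest_gf_def Gtilde_eq_sum_tree_weight)
    qed
    have "fps_nth tree_gf n = (\<Sum>ts\<in>forests (Suc m). tree_weight (Node ts))"
      using Suc by (simp add: tree_gf_def Gtilde_eq_sum_tree_weight plane_trees_eq_image
          sum.reindex inj_on_def)
    also have "\<dots> = fps_nth ?first_leaf m + d * t * fps_nth (tree_gf * forest_gf) m"
      by (simp add: sum_forests_Suc summand sum.distrib sum_distrib_left fps_mult_nth
          atLeast0AtMost del: fps_add_nth)
    finally show ?thesis using Suc by simp
  qed
qed

lemma tree_gf_quadratic:
  defines "X \<equiv> fps_X :: 'r fps"
  defines "A \<equiv> fps_const a" and "B \<equiv> fps_const b" and "C \<equiv> fps_const c"
    and "E \<equiv> fps_const d" and "S \<equiv> fps_const t" and "W \<equiv> tree_gf"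
  shows "S * X * W * W + (S * X * (C + E) - 1 + S * X * X * (B - A)) * W
    + (X * A + S * X * X * C * (B - A)) = 0"
proof -
  define F where "F = forest_gf"
  define Y where "Y = X * (S * (C + W))"
  have F: "F * (1 - Y) = 1"
    using forest_gf_eq unfolding F_def Y_def branch_gf_def X_def S_def C_def W_def
    by (simp add: algebra_simps)
  have W: "W = X * (A + B * (F - 1) + E * S * (W * F))"
    using tree_gf_eq unfolding F_def X_def A_def B_def E_def S_def W_def
    by (simp flip: fps_const_mult)
  \<comment> \<open>Since \<open>1 - Y\<close> is inverse to \<open>F\<close>, multiplying by it
    eliminates \<open>F\<close> without any division.\<close>
  have "W * (1 - Y) = X * (A * (1 - Y) + B * (F * (1 - Y) - (1 - Y)) + E * S * (W * (F * (1 - Y))))"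
    by (subst W) (simp add: algebra_simps)
  also have "\<dots> = X * (A * (1 - Y) + B * Y + E * S * W)"
    unfolding F by simp
  finally show ?thesis unfolding Y_def by (simp add: algebra_simps)
qed

end

text \<open>From \<open>F = fps_X * (U * F)\<close>, each coefficient of \<open>F\<close> is a
  combination of earlier ones, so all vanish by strong induction. Thus a factor with constant term 1
  cancels over any commutative ring.\<close>

lemma fps_eq_zeroI_mult:
  fixes F U :: "'r::comm_ring_1 fps"
  assumes "(1 - fps_X * U) * F = 0"
  shows "F = 0"
proof -
  have F: "F = fps_X * (U * F)" using assms by (simp add: algebra_simps)
  have "fps_nth F n = 0" for n
  proof (induction n rule: less_induct)
    case (less n)
    then show ?case
      by (subst F) (cases n, auto simp: fps_mult_nth intro!: sum.neutral)
  qed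
  then show ?thesis by (simp add: fps_eq_iff)
qed

section \<open>The formal derivative carried over to power series\<close>

lemma Const_simps [simp]: "Const 0 = 0" "Const 1 = 1"
  by (simp_all add: Const_def)

context
  fixes f :: "'v \<Rightarrow> 'v qpoly" and D
  assumes D: "formal_derivative f D"
begin

lemma formal_derivative_simps:
  "D (p + q) = D p + D q" "D (p * q) = D p * q + p * D q" "D (Var v) = f v"
  using D by (auto simp: formal_derivative_def)

lemma formal_derivative_0_1 [simp]: "D 0 = 0" "D 1 = 0"
  using D unfolding formal_derivative_def by (metis Const_simps)+

lemma formal_derivative_of_nat: "D (of_nat n) = 0"
  by (induction n) (simp_all add: formal_derivative_simps)

lemma formal_derivative_sum: "D (sum g A) = (\<Sum>x\<in>A. D (g x))"
  by (induction A rule: infinite_finite_induct) (simp_all add: formal_derivative_simps)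

text \<open>The derivation \<open>x D - x d/dx\<close> on power series in \<open>x\<close>, where \<open>D\<close> acts on coefficients.\<close>

definition euler_shift :: "'v qpoly fps \<Rightarrow> 'v qpoly fps" where
  "euler_shift F = fps_X * (Abs_fps (\<lambda>n. D (fps_nth F n)) - fps_deriv F)"

lemma euler_shift_add: "euler_shift (F + G) = euler_shift F + euler_shift G"
proof -
  have "Abs_fps (\<lambda>n. D (fps_nth (F + G) n)) =
      Abs_fps (\<lambda>n. D (fps_nth F n)) + Abs_fps (\<lambda>n. D (fps_nth G n))"
    by (simp add: fps_eq_iff formal_derivative_simps)
  then show ?thesis by (simp add: euler_shift_def algebra_simps)
qed

lemma euler_shift_diff: "euler_shift (F - G) = euler_shift F - euler_shift G"
  using euler_shift_add[of "F - G" G] by simp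

lemma euler_shift_mult: "euler_shift (F * G) = euler_shift F * G + F * euler_shift G"
proof -
  have "Abs_fps (\<lambda>n. D (fps_nth (F * G) n)) =
      Abs_fps (\<lambda>n. D (fps_nth F n)) * G + F * Abs_fps (\<lambda>n. D (fps_nth G n))"
    by (simp add: fps_eq_iff fps_mult_nth formal_derivative_sum formal_derivative_simps sum.distrib)
  then show ?thesis by (simp add: euler_shift_def algebra_simps)
qed

lemma euler_shift_const: "euler_shift (fps_const p) = fps_X * fps_const (D p)"
  by (auto simp: euler_shift_def fps_eq_iff)

lemma euler_shift_X: "euler_shift fps_X = - fps_X"
proof -
  have "Abs_fps (\<lambda>n. D (fps_nth fps_X n)) = 0"
    by (auto simp: fps_eq_iff fps_X_def)
  then show ?thesis by (simp add: euler_shift_def)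
qed

lemma euler_shift_0_1: "euler_shift 0 = 0" "euler_shift 1 = 0"
  using euler_shift_const[of 0] euler_shift_const[of 1] by simp_all

end

section \<open>The differential equation, the recurrence for \<open>Gtilde\<close>, and the
  theorem\<close>

lemma tree_gf_differential_equation:
  assumes D: "formal_derivative grammar D"
  defines "W \<equiv> tree_gf va vb vc vd vt"
  shows "euler_shift D W = W - fps_const (2 * va) * fps_X"
proof -
  define X where "X = (fps_X :: letter qpoly fps)"
  define A B C E S where letters: "A = fps_const va" "B = fps_const vb" "C = fps_const vc"
    "E = fps_const vd" "S = fps_const vt"
  define \<Delta> where "\<Delta> = euler_shift D"
  note rules = euler_shift_add[OF D, folded \<Delta>_def] euler_shift_diff[OF D, folded \<Delta>_def]
    euler_shift_mult[OF D, folded \<Delta>_def] euler_shift_0_1[OF D, folded \<Delta>_def]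
    euler_shift_X[OF D, folded \<Delta>_def X_def]
  have num: "fps_const (numeral k) = (numeral k :: letter qpoly fps)" for k
    by (simp add: numeral_fps_const)
  have \<Delta>_letters: "\<Delta> A = 3 * X * S * (A * E + B * C)" "\<Delta> B = 3 * X * S * (A * E + B * C)"
    "\<Delta> C = 2 * X * A" "\<Delta> E = 2 * X * B" "\<Delta> S = X * S * S * (C + E)"
    unfolding \<Delta>_def letters X_def euler_shift_const[OF D] formal_derivative_simps[OF D]
    by (simp_all add: algebra_simps power2_eq_square num flip: fps_const_mult fps_const_add)
  have P: "S * X * W * W + (S * X * (C + E) - 1 + S * X * X * (B - A)) * W
      + (X * A + S * X * X * C * (B - A)) = 0" (is "?P = 0")
    unfolding W_def letters X_def by (rule tree_gf_quadratic)
  define P_W where "P_W = 2 * S * X * W + S * X * (C + E) - 1 + S * X * X * (B - A)"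
  have "\<Delta> ?P = 0" using P rules by simp
  \<comment> \<open>By the Leibniz rule \<open>\<Delta> ?P\<close> is linear in
    \<open>\<Delta> W\<close> with coefficient \<open>P_W\<close>, the derivative of
    \<open>?P\<close> in \<open>W\<close>. Once the letters are differentiated, what remains is an
    identity of polynomials.\<close>
  moreover have "P_W * (\<Delta> W - (W - 2 * A * X)) = \<Delta> ?P - (1 + S * X * (C + E)) * ?P"
    unfolding rules \<Delta>_letters P_W_def by (simp add: algebra_simps)
  ultimately have "P_W * (\<Delta> W - (W - 2 * A * X)) = 0" using P by simp
  \<comment> \<open>Exhibits \<open>P_W\<close> as minus a series with constant term 1, which is the
    form that can be cancelled.\<close>
  moreover have "P_W * Q = - ((1 - X * (2 * S * W + S * (C + E) + S * X * (B - A))) * Q)" for Q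
    by (simp add: P_W_def algebra_simps)
  ultimately have "(1 - X * (2 * S * W + S * (C + E) + S * X * (B - A)))
      * (\<Delta> W - (W - 2 * A * X)) = 0" by (simp only: neg_equal_0_iff_equal)
  then have "\<Delta> W - (W - 2 * A * X) = 0"
    unfolding X_def by (rule fps_eq_zeroI_mult)
  then show ?thesis by (simp add: \<Delta>_def letters X_def num flip: fps_const_mult)
qed

text \<open>Coefficient \<open>n + 1\<close> of the differential equation reads
  \<open>D G - (n + 1) G' = G'\<close> with \<open>G\<close>, \<open>G'\<close> for indices
  \<open>n\<close>, \<open>n + 1\<close>. The correction \<open>2 * va\<close> sits at exponent 1,
  out of reach for \<open>n \<ge> 1\<close>.\<close>

lemma derivative_Gtilde:
  assumes D: "formal_derivative grammar D" and n: "n \<ge> 1"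
  shows "D (Gtilde n va vb vc vd vt) = of_nat (n + 2) * Gtilde (n + 1) va vb vc vd vt"
proof -
  have "fps_nth (euler_shift D (tree_gf va vb vc vd vt)) (Suc n) =
      fps_nth (tree_gf va vb vc vd vt - fps_const (2 * va) * fps_X) (Suc n)"
    by (simp only: tree_gf_differential_equation[OF D])
  then show ?thesis using n
    by (simp add: euler_shift_def[OF D] tree_gf_def algebra_simps)
qed

lemma Gtilde_1: "Gtilde 1 a b c d t = (a :: 'r::comm_ring_1)"
proof -
  have "forests 1 = {[Node []]}"
    using forests_Suc[of 0] by (simp add: Sigma_def plane_trees_0 forests_0)
  then show ?thesis
    unfolding Gtilde_eq_sum_tree_weight[OF zero_less_one]
    by (simp add: plane_trees_eq_image tree_weight_Node_Cons)
qed

theorem theorem3p1: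
  fixes D :: "letter qpoly \<Rightarrow> letter qpoly" and n :: nat
  assumes "formal_derivative grammar D"
    and "n \<ge> 2"
  shows "(D ^^ n) vd = fact (n + 1) * Gtilde n va vb vc vd vt"
  using \<open>n \<ge> 2\<close>
proof (induction n rule: dec_induct)
  case base
  note D = formal_derivative_simps[OF assms(1)]
  \<comment> \<open>\<open>D vd\<close> is \<open>2 * vb\<close>, and the grammar gives
    \<open>va\<close> and \<open>vb\<close> the same image. Passing to \<open>va\<close>, which is
    \<open>Gtilde 1\<close>, makes the recurrence applicable at index 1; then \<open>2 * 3\<close>
    is the factorial of 3.\<close>
  have "(D ^^ 2) vd = 2 * D va"
    using formal_derivative_of_nat[OF assms(1), of 2] by (simp add: numeral_2_eq_2 D)
  also have "D va = D (Gtilde 1 va vb vc vd vt)" by (simp only: Gtilde_1)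
  also have "\<dots> = 3 * Gtilde 2 va vb vc vd vt"
    using derivative_Gtilde[OF assms(1), of 1] by (simp add: numeral_2_eq_2)
  finally show ?case by (simp add: fact_numeral)
next
  case (step n)
  have "D (fact (n + 1) * p) = fact (n + 1) * D p" for p
    using formal_derivative_of_nat[OF assms(1), of "fact (n + 1)"]
    by (simp add: formal_derivative_simps[OF assms(1)] del: fact_Suc)
  then have "(D ^^ Suc n) vd = fact (n + 1) * D (Gtilde n va vb vc vd vt)"
    using step.IH by (simp del: fact_Suc)
  also have "\<dots> = fact (Suc n + 1) * Gtilde (Suc n) va vb vc vd vt"
    using step.hyps by (simp add: derivative_Gtilde[OF assms(1)] algebra_simps)
  finally show ?case .
qed

end
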